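(* Let $n\ge 3$, $1\le t<n$, and let $c_1,c_2,\ldots,c_t\in[n]$ be distinct integers such that the sequence $(c_1,\ldots,c_t)$ avoids both patterns $132$ and $312$. If $\{c_1,\ldots,c_t\}$ is a set of consecutive integers, then $$|S_{n,(c_1,\ldots,c_t)}(132,312)|=\binom{n-t}{\min\{c_1,\ldots,c_t\}-1};$$ otherwise, $|S_{n,(c_1,\ldots,c_t)}(132,312)|=0$.
   Context: $[n]=\{1,\ldots,n\}$ and $S_n$ is the set of permutations of $[n]$ written as sequences $(\tau(1),\ldots,\tau(n))$. A sequence of distinct integers $\tau=(\tau(1),\ldots,\tau(m))$ contains $\sigma\in S_k$ as a pattern if there are indices $1\le i_1<\cdots<i_k\le m$ such that for all $1\le a<b\le k$, $\tau(i_a)<\tau(i_b)$ if and only if $\sigma(a)<\sigma(b)$; otherwise $\tau$ avoids $\sigma$. $S_{n,(c_1,\ldots,c_t)}(\sigma_1,\ldots,\sigma_m)$ is the set of $\tau\in S_n$ with $(\tau(1),\ldots,\tau(t))=(c_1,\ldots,c_t)$ that avoid all of $\sigma_1,\ldots,\sigma_m$. A set of $t$ integers is a set of consecutive integers if it equals $\{x,x+1,\ldots,x+t-1\}$ for some $x$. *)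

theory Defs
  imports "HOL-Combinatorics.Multiset_Permutations"
begin

text \<open>
  Sequences are lists, so positions are counted from 0 while the entries of a permutation
  of \<open>[n]\<close> are \<open>1, ..., n\<close>. The function \<open>i\<close> below lists the positions of an occurrence of the
  pattern, \<open>i 0 < i 1 < ...\<close>.
\<close>

definition contains_pattern :: "'a::linorder list \<Rightarrow> nat list \<Rightarrow> bool" where
  "contains_pattern \<tau> \<sigma> \<longleftrightarrow>
     (\<exists>i :: nat \<Rightarrow> nat.
        strict_mono_on {..<length \<sigma>} i \<and>
        (\<forall>a<length \<sigma>. i a < length \<tau>) \<and>
        (\<forall>a b. a < b \<and> b < length \<sigma> \<longrightarrow>
           (\<tau> ! i a < \<tau> ! i b \<longleftrightarrow> \<sigma> ! a < \<sigma> ! b)))"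

definition avoids_pattern :: "'a::linorder list \<Rightarrow> nat list \<Rightarrow> bool" where
  "avoids_pattern \<tau> \<sigma> \<longleftrightarrow> \<not> contains_pattern \<tau> \<sigma>"

abbreviation perms :: "nat \<Rightarrow> nat list set" where
  "perms n \<equiv> permutations_of_set {1..n}"

definition avoiding_perms_with_prefix :: "nat \<Rightarrow> nat list \<Rightarrow> nat list set \<Rightarrow> nat list set" where
  "avoiding_perms_with_prefix n c \<Sigma> =
     {\<tau> \<in> perms n. take (length c) \<tau> = c \<and> (\<forall>\<sigma>\<in>\<Sigma>. avoids_pattern \<tau> \<sigma>)}"

definition consecutive :: "nat set \<Rightarrow> bool" where
  "consecutive C \<longleftrightarrow> (\<exists>x. C = {x..<x + card C})"

end

theory Submission
  imports Defs
begin

text \<open>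
  Together the two patterns forbid an entry strictly between two earlier entries. In a permutation
  of \<open>[n]\<close> the values missing from a prefix all occur later, so every prefix must have a set of
  consecutive values, and an interval \<open>{a..<b}\<close> can only be continued by \<open>a - 1\<close> or \<open>b\<close>. The number
  of continuations thus satisfies Pascal's recurrence.
\<close>

section \<open>Avoidance of 132 and 312 as one condition on triples\<close>

definition no_later_between :: "'a::linorder list \<Rightarrow> bool" where
  "no_later_between xs \<longleftrightarrow>
     (\<forall>i j k. i < k \<longrightarrow> j < k \<longrightarrow> k < length xs \<longrightarrow> \<not> (xs ! i < xs ! k \<and> xs ! k < xs ! j))"

lemma no_later_betweenD:
  assumes "no_later_between xs" "i < k" "j < k" "k < length xs" "xs ! i < xs ! k"
  shows "xs ! j \<le> xs ! k"
  using assms unfolding no_later_between_def by (meson not_le)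

lemma contains_pattern_length3:
  "contains_pattern xs [p, q, r] \<longleftrightarrow>
     (\<exists>i j k. i < j \<and> j < k \<and> k < length xs \<and>
        (xs ! i < xs ! j \<longleftrightarrow> p < q) \<and> (xs ! i < xs ! k \<longleftrightarrow> p < r) \<and> (xs ! j < xs ! k \<longleftrightarrow> q < r))"
  (is "?L \<longleftrightarrow> ?R")
proof
  assume ?L
  then obtain f :: "nat \<Rightarrow> nat" where mono: "strict_mono_on {..<3} f"
    and len: "\<forall>a<3. f a < length xs"
    and ord: "\<And>a b. a < b \<Longrightarrow> b < 3 \<Longrightarrow>
      (xs ! f a < xs ! f b \<longleftrightarrow> [p, q, r] ! a < [p, q, r] ! b)"
    unfolding contains_pattern_def by (auto simp: numeral_3_eq_3)
  have "f 0 < f 1" "f 1 < f 2"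
    using mono by (auto simp: strict_mono_on_def)
  moreover have "f 2 < length xs"
    using len by simp
  ultimately show ?R
    using ord[of 0 1] ord[of 0 2] ord[of 1 2] by (intro exI[of _ "f 0"] exI[of _ "f 1"] exI[of _ "f 2"]) simp
next
  assume ?R
  then obtain i j k where *: "i < j" "j < k" "k < length xs"
    "xs ! i < xs ! j \<longleftrightarrow> p < q" "xs ! i < xs ! k \<longleftrightarrow> p < r" "xs ! j < xs ! k \<longleftrightarrow> q < r"
    by blast
  then show ?L
    unfolding contains_pattern_def
    by (intro exI[of _ "\<lambda>a. [i, j, k] ! a"])
       (auto simp: strict_mono_on_def less_Suc_eq)
qed

text \<open>In \<open>no_later_between\<close> the positions \<open>i\<close> and \<open>j\<close>
  are not ordered: a violation with \<open>i < j\<close> is an occurrence of 132, one with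
  \<open>j < i\<close> an occurrence of 312. Distinctness serves the converse, because
  \<open>contains_pattern\<close> encodes a descent as a failed \<open><\<close>, which could also
  be an equality.\<close>

lemma avoids_132_312_iff:
  assumes "distinct xs"
  shows "avoids_pattern xs [1, 3, 2] \<and> avoids_pattern xs [3, 1, 2] \<longleftrightarrow> no_later_between xs"
proof
  assume avoids: "avoids_pattern xs [1, 3, 2] \<and> avoids_pattern xs [3, 1, 2]"
  show "no_later_between xs"
    unfolding no_later_between_def
  proof (intro allI impI notI)
    fix i j k
    assume *: "i < k" "j < k" "k < length xs" "xs ! i < xs ! k \<and> xs ! k < xs ! j"
    then consider "i < j" | "j < i"
      by (metis less_asym linorder_neqE_nat)
    then show False
    proof cases
      case 1
      with * have "contains_pattern xs [1, 3, 2]"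
        unfolding contains_pattern_length3
        by (intro exI[of _ i] exI[of _ j] exI[of _ k]) auto
      with avoids show False by (simp add: avoids_pattern_def)
    next
      case 2
      with * have "contains_pattern xs [3, 1, 2]"
        unfolding contains_pattern_length3
        by (intro exI[of _ j] exI[of _ i] exI[of _ k]) auto
      with avoids show False by (simp add: avoids_pattern_def)
    qed
  qed
next
  assume good: "no_later_between xs"
  have "\<not> contains_pattern xs [1, 3, 2]"
  proof
    assume "contains_pattern xs [1, 3, 2]"
    then obtain i j k where *: "i < j" "j < k" "k < length xs" "xs ! i < xs ! k" "\<not> xs ! j < xs ! k"
      unfolding contains_pattern_length3 by auto
    with no_later_betweenD[OF good, of i k j] have "xs ! j = xs ! k"
      by force
    with * assms show False by (simp add: nth_eq_iff_index_eq)
  qed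
  moreover have "\<not> contains_pattern xs [3, 1, 2]"
  proof
    assume "contains_pattern xs [3, 1, 2]"
    then obtain i j k where *: "i < j" "j < k" "k < length xs" "xs ! j < xs ! k" "\<not> xs ! i < xs ! k"
      unfolding contains_pattern_length3 by auto
    with no_later_betweenD[OF good, of j k i] have "xs ! i = xs ! k"
      by force
    with * assms show False by (simp add: nth_eq_iff_index_eq)
  qed
  ultimately show "avoids_pattern xs [1, 3, 2] \<and> avoids_pattern xs [3, 1, 2]"
    by (simp add: avoids_pattern_def)
qed

text \<open>Only triples with \<open>k\<close> at the new last position are new, and an entry beyond
  all others on one side is never a middle value.\<close>

lemma no_later_between_snoc:
  assumes "no_later_between xs" "(\<forall>x\<in>set xs. z < x) \<or> (\<forall>x\<in>set xs. x < z)"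
  shows "no_later_between (xs @ [z])"
  unfolding no_later_between_def
proof (intro allI impI notI)
  fix i j k
  assume *: "i < k" "j < k" "k < length (xs @ [z])"
    "(xs @ [z]) ! i < (xs @ [z]) ! k \<and> (xs @ [z]) ! k < (xs @ [z]) ! j"
  show False
  proof (cases "k < length xs")
    case True
    with * have "xs ! i < xs ! k" "xs ! k < xs ! j"
      by (simp_all add: nth_append)
    with no_later_betweenD[OF assms(1) *(1,2) True] show False by simp
  next
    case False
    with * have "xs ! i \<in> set xs" "xs ! j \<in> set xs" "xs ! i < z" "z < xs ! j"
      by (auto simp: nth_append)
    with assms(2) show False by (meson less_asym)
  qed
qed

lemma avoiding_perms_with_prefix_132_312:
  "avoiding_perms_with_prefix n c {[1, 3, 2], [3, 1, 2]} =
     {\<tau> \<in> perms n. take (length c) \<tau> = c \<and> no_later_between \<tau>}"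
  unfolding avoiding_perms_with_prefix_def
  by (auto simp: avoids_132_312_iff[symmetric] dest: permutations_of_setD)

section \<open>Values missing from a prefix\<close>

lemma value_after_prefix:
  assumes \<tau>: "\<tau> \<in> perms n" "take (length c) \<tau> = c" and y: "y \<in> {1..n}" "y \<notin> set c"
  obtains k where "length c \<le> k" "k < length \<tau>" "\<tau> ! k = y"
proof -
  from \<tau> y obtain k where k: "k < length \<tau>" "\<tau> ! k = y"
    by (metis in_set_conv_nth permutations_of_setD(1))
  moreover have "length c \<le> k"
  proof (rule ccontr)
    assume "\<not> length c \<le> k"
    then have "\<tau> ! k = c ! k" "k < length c"
      using \<tau>(2) by (metis not_le nth_take, simp)
    with k y show False by (metis nth_mem)
  qed
  ultimately show thesis using that by blast
qed

text \<open>A value between two entries of \<open>c\<close> lies in \<open>{1..n}\<close>; if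
  \<open>c\<close> missed it, it would occur later and form a forbidden triple with those entries.
  This is used for \<open>c\<close> itself and for \<open>c\<close> extended by one entry.\<close>

lemma value_after_prefix_not_between:
  assumes "\<tau> \<in> perms n" "take (length c) \<tau> = c" "no_later_between \<tau>"
    and "x \<in> set c" "z \<in> set c" "x < y" "y < z"
  shows "y \<in> set c"
proof (rule ccontr)
  assume y: "y \<notin> set c"
  have "set c \<subseteq> {1..n}"
    using assms(1,2) by (metis permutations_of_setD(1) set_take_subset)
  then have "y \<in> {1..n}"
    using assms(4-7) by fastforce
  then obtain k where k: "length c \<le> k" "k < length \<tau>" "\<tau> ! k = y"
    using value_after_prefix[OF assms(1,2) _ y] by blast
  obtain i j where "i < length c" "c ! i = x" "j < length c" "c ! j = z"
    using assms(4,5) by (meson in_set_conv_nth)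
  moreover have "\<tau> ! m = c ! m" if "m < length c" for m
    using assms(2) that by (metis nth_take)
  ultimately show False
    using no_later_betweenD[OF assms(3), of i k j] k assms(6,7) by simp
qed

lemma consecutive_if_convex:
  assumes "finite C" "C \<noteq> {}"
    and "\<And>x y z. x \<in> C \<Longrightarrow> z \<in> C \<Longrightarrow> x < y \<Longrightarrow> y < z \<Longrightarrow> y \<in> C"
  shows "consecutive C"
proof -
  \<comment> \<open>The start of the run is \<open>Min C\<close>; its length then agrees with
    \<open>card C\<close>.\<close>
  have "C = {Min C..<Suc (Max C)}"
  proof (intro equalityI subsetI)
    fix y assume "y \<in> {Min C..<Suc (Max C)}"
    then consider "y = Min C" | "y = Max C" | "Min C < y" "y < Max C"
      by fastforce
    then show "y \<in> C"
      by cases (use assms(1,2) assms(3)[OF Min_in Max_in] in simp_all)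
  next
    fix y assume "y \<in> C"
    with assms(1) show "y \<in> {Min C..<Suc (Max C)}"
      by (simp add: less_Suc_eq_le)
  qed
  moreover have "Min C \<le> Max C"
    using assms(1,2) by simp
  ultimately show ?thesis
    unfolding consecutive_def
    by (metis card_atLeastLessThan le_SucI le_add_diff_inverse)
qed

section \<open>Counting the continuations of an interval\<close>

lemma next_value_after_interval:
  assumes "\<tau> \<in> perms n" "take (length c) \<tau> = c" "no_later_between \<tau>"
    and "length c < n" "set c = {a..<b}" "1 \<le> a" "a < b" "b \<le> Suc n"
  shows "\<tau> ! length c = a - 1 \<and> 2 \<le> a \<or> \<tau> ! length c = b \<and> b \<le> n"
proof -
  let ?t = "length c"
  let ?x = "\<tau> ! ?t"
  have len: "length \<tau> = n" and set: "set \<tau> = {1..n}" and dist: "distinct \<tau>"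
    using assms(1) by (auto dest: permutations_of_setD length_finite_permutations_of_set)
  then have take: "take (Suc ?t) \<tau> = c @ [?x]"
    using assms(2,4) by (simp add: take_Suc_conv_app_nth)
  have x: "?x \<in> {1..n}"
    using set len assms(4) by (metis nth_mem)
  have "distinct (c @ [?x])"
    using dist take by (metis distinct_take)
  then have out: "?x \<notin> {a..<b}"
    using assms(5) by simp
  \<comment> \<open>The prefix that is one entry longer is convex too, so \<open>?x\<close> cannot
    leave a gap next to the interval: a jump would skip \<open>a - 1\<close> or
    \<open>b\<close>.\<close>
  have between: "y \<in> set (c @ [?x])"
    if "u \<in> set (c @ [?x])" "v \<in> set (c @ [?x])" "u < y" "y < v" for u v y
    using value_after_prefix_not_between[of \<tau> n "c @ [?x]" u v y] that assms(1,3) take by simp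
  show ?thesis
  proof (cases "?x < a")
    case True
    have "\<not> ?x < a - 1"
    proof
      assume "?x < a - 1"
      then have "a - 1 \<in> set (c @ [?x])"
        using assms(5-7) between[of ?x a "a - 1"] by auto
      with \<open>?x < a - 1\<close> assms(5,6) show False by auto
    qed
    with True x show ?thesis by auto
  next
    case False
    with out have "b \<le> ?x" by simp
    moreover have "\<not> b < ?x"
    proof
      assume "b < ?x"
      then have "b \<in> set (c @ [?x])"
        using assms(5-7) between[of a ?x b] by auto
      with \<open>b < ?x\<close> assms(5) show False by auto
    qed
    ultimately show ?thesis using x by auto
  qed
qed

text \<open>Each remaining entry extends the interval downwards or upwards, and exactly
  \<open>a - 1\<close> of them go down; the binomial coefficient chooses when. The induction is on
  the number of remaining entries, with \<open>c\<close>, \<open>a\<close> and \<open>b\<close>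
  arbitrary because each step changes the interval.\<close>

lemma card_no_later_between_with_prefix:
  assumes "no_later_between c" "distinct c" "set c = {a..<b}" "1 \<le> a" "a < b" "b \<le> Suc n"
  shows "card {\<tau> \<in> perms n. take (length c) \<tau> = c \<and> no_later_between \<tau>} =
    (n - length c) choose (a - 1)"
  using assms
proof (induction "n - length c" arbitrary: c a b)
  case (0 c a b)
  have len: "length c = b - a"
    using 0 by (metis card_atLeastLessThan distinct_card)
  \<comment> \<open>With no entries left, the interval has at least \<open>n\<close> elements and so
    fills \<open>{1..n}\<close>.\<close>
  with 0 have ab: "a = 1" "b = Suc n" by auto
  have "set c = {1..n}"
    using 0(4) ab by (simp add: atLeastLessThanSuc_atLeastAtMost)
  with 0(3) have "c \<in> perms n" "length c = n"
    using len ab by (simp_all add: permutations_of_set_def)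
  then have "{\<tau> \<in> perms n. take (length c) \<tau> = c \<and> no_later_between \<tau>} = {c}"
    using 0(2) by (auto dest: length_finite_permutations_of_set)
  with ab show ?case by simp
next
  case (Suc d c a b)
  define A where "A c = {\<tau> \<in> perms n. take (length c) \<tau> = c \<and> no_later_between \<tau>}" for c
  have len: "length c = b - a"
    using Suc by (metis card_atLeastLessThan distinct_card)
  have fin: "finite (A xs)" for xs
    unfolding A_def by (rule finite_subset[of _ "perms n"]) auto
  have sub: "A (c @ [x]) \<subseteq> A c" for x
  proof
    fix \<tau> assume "\<tau> \<in> A (c @ [x])"
    then have "\<tau> \<in> perms n" "no_later_between \<tau>" "take (Suc (length c)) \<tau> = c @ [x]"
      by (auto simp: A_def)
    moreover have "take (length c) \<tau> = take (length c) (take (Suc (length c)) \<tau>)"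
      by (simp add: min_def)
    ultimately show "\<tau> \<in> A c"
      by (simp add: A_def)
  qed
  have cover: "\<tau> \<in> A (c @ [a - 1]) \<and> 2 \<le> a \<or> \<tau> \<in> A (c @ [b]) \<and> b \<le> n" if "\<tau> \<in> A c" for \<tau>
  proof -
    have "length \<tau> = n"
      using that by (auto simp: A_def dest: length_finite_permutations_of_set)
    then have "\<tau> \<in> A (c @ [\<tau> ! length c])"
      using that Suc.hyps(2) by (simp add: A_def take_Suc_conv_app_nth)
    moreover have "\<tau> ! length c = a - 1 \<and> 2 \<le> a \<or> \<tau> ! length c = b \<and> b \<le> n"
      using that Suc.hyps(2) Suc.prems by (intro next_value_after_interval) (simp_all add: A_def)
    ultimately show ?thesis by metis
  qed
  have d: "d = n - Suc (length c)"
    using Suc.hyps(2) by simp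
  \<comment> \<open>The new lower end is \<open>a - 1\<close>, so the induction hypothesis has
    \<open>a - 2\<close> below; \<open>2 \<le> a\<close> keeps that end positive.\<close>
  have below: "card (A (c @ [a - 1])) = d choose (a - 2)" if "2 \<le> a"
  proof -
    have "set (c @ [a - 1]) = {a - 1..<b}"
      using Suc.prems that by auto
    moreover have "no_later_between (c @ [a - 1])"
      using Suc.prems that by (intro no_later_between_snoc) auto
    ultimately show ?thesis
      using Suc.hyps(1)[of "c @ [a - 1]" "a - 1" b] d Suc.prems that
      by (simp add: A_def numeral_2_eq_2)
  qed
  have above: "card (A (c @ [b])) = d choose (a - 1)" if "b \<le> n"
  proof -
    have "set (c @ [b]) = {a..<Suc b}"
      using Suc.prems by auto
    moreover have "no_later_between (c @ [b])"
      using Suc.prems by (intro no_later_between_snoc) auto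
    ultimately show ?thesis
      using Suc.hyps(1)[of "c @ [b]" a "Suc b"] d Suc.prems that
      by (simp add: A_def)
  qed
  have disj: "A (c @ [a - 1]) \<inter> A (c @ [b]) = {}"
    using Suc.prems by (auto simp: A_def)
  \<comment> \<open>The missing values are those below the interval and those above it. As
    \<open>Suc d\<close> is positive, at least one side has room.\<close>
  have total: "Suc d = (a - 1) + (Suc n - b)"
    using Suc.hyps(2) Suc.prems len by linarith
  \<comment> \<open>With room on both sides the count is Pascal's rule. Otherwise the continuation
    is forced and both coefficients equal 1: lower index 0 if \<open>a = 1\<close>, lower index
    equal to the upper one if \<open>b = Suc n\<close>.\<close>
  consider "2 \<le> a" "b \<le> n" | "a = 1" "b \<le> n" | "2 \<le> a" "b = Suc n"
    using Suc.prems total by linarith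
  then have "card (A c) = Suc d choose (a - 1)"
  proof cases
    case 1
    then have "A c = A (c @ [a - 1]) \<union> A (c @ [b])"
      using cover sub by blast
    then have "card (A c) = (d choose (a - 2)) + (d choose (a - 1))"
      using below above 1 disj fin by (simp add: card_Un_disjoint)
    moreover have "a - 1 = Suc (a - 2)"
      using 1 by simp
    ultimately show ?thesis by simp
  next
    case 2
    then have "A c = A (c @ [b])"
      using cover sub by fastforce
    with 2 above show ?thesis by simp
  next
    case 3
    then have "A c = A (c @ [a - 1])"
      using cover sub by fastforce
    moreover have "a - 2 = d" "a - 1 = Suc d"
      using total 3 by auto
    ultimately show ?thesis using below 3 by simp
  qed
  then show ?case
    using Suc.hyps(2) by (simp add: A_def)
qed

theorem theorem5p2:
  fixes n t :: nat and c :: "nat list"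
  assumes "n \<ge> 3" and "1 \<le> t" and "t < n"
    and "length c = t" and "set c \<subseteq> {1..n}" and "distinct c"
    and "avoids_pattern c [1, 3, 2]" and "avoids_pattern c [3, 1, 2]"
  shows "card (avoiding_perms_with_prefix n c {[1, 3, 2], [3, 1, 2]}) =
    (if consecutive (set c) then (n - t) choose (Min (set c) - 1) else 0)"
proof (cases "consecutive (set c)")
  case True
  then obtain a where a: "set c = {a..<a + t}"
    using assms by (auto simp: consecutive_def distinct_card)
  \<comment> \<open>Since \<open>t\<close> is positive, both ends of the interval are entries of
    \<open>c\<close>, which bounds them by 1 and \<open>n\<close>.\<close>
  then have "a \<in> set c" "a + t - 1 \<in> set c"
    using assms(2) by auto
  then have "1 \<le> a" "a + t \<le> Suc n"
    using assms(5) by fastforce+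
  moreover have "Min (set c) = a"
    using a assms(2) by (intro Min_eqI) auto
  moreover have "no_later_between c"
    using assms avoids_132_312_iff by blast
  ultimately show ?thesis
    using True card_no_later_between_with_prefix[of c a "a + t" n] a assms
    by (simp add: avoiding_perms_with_prefix_132_312 del: One_nat_def)
next
  case False
  \<comment> \<open>A single member would already make \<open>set c\<close> convex, hence
    consecutive.\<close>
  have "avoiding_perms_with_prefix n c {[1, 3, 2], [3, 1, 2]} = {}"
  proof (rule ccontr)
    assume "avoiding_perms_with_prefix n c {[1, 3, 2], [3, 1, 2]} \<noteq> {}"
    then obtain \<tau> where "\<tau> \<in> perms n" "take (length c) \<tau> = c" "no_later_between \<tau>"
      by (auto simp: avoiding_perms_with_prefix_132_312 simp del: One_nat_def)
    then have "y \<in> set c" if "x \<in> set c" "z \<in> set c" "x < y" "y < z" for x y z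
      using value_after_prefix_not_between that by blast
    moreover have "set c \<noteq> {}"
      using assms(2,4) by auto
    ultimately have "consecutive (set c)"
      by (metis consecutive_if_convex List.finite_set)
    with False show False ..
  qed
  with False show ?thesis by simp
qed

end
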